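(* Let $(G,\sigma,w)$ be a non-complete positive connected signed graph (non-complete: there are two distinct vertices of $G$ that are not adjacent in $G$) and let $\epsilon_0$ be its consensus index. For every $\epsilon<\epsilon_0$, let $\lambda_2^{(\epsilon)}$ be the second smallest eigenvalue of $L_+-\epsilon L_-$ and let $M_\epsilon:=\max_{x\in V}(d_x^+-\epsilon d_x^-)$. Then $$\lambda_2^{(\epsilon)}\le M_\epsilon .$$
   Context: A signed graph $(G,\sigma,w)$ consists of a finite simple undirected connected graph $G=(V,E)$, a symmetric signature $\sigma:E\to\{+1,-1\}$ and a symmetric weight $w:E\to\mathbb{R}_{\ge 0}$. Put $E_+=\sigma^{-1}(+1)$, $E_-=\sigma^{-1}(-1)$. Let $w^{\pm}$ be the restriction of $w$ to $E_\pm$, extended by zero to all pairs of vertices. Put $d_i^{\pm}=\sum_{j:(i,j)\in E_\pm}w_{ij}$. The positive subgraph is $(V,E_+,w^+)$; the signed graph is positive connected if its positive subgraph is connected. The matrices $L_\pm\in\mathbb{R}^{V\times V}$ are the Laplacians of $(V,E_\pm,w^\pm)$: $L_\pm(i,i)=d_i^\pm$, $L_\pm(i,j)=-w_{ij}$ if $(i,j)\in E_\pm$, and $L_\pm(i,j)=0$ otherwise. With $n=|V|$, the consensus index is $$\epsilon_0:=\sup\{\epsilon>0 : L_+-\epsilon L_-\text{ is positive semidefinite of rank } n-1\}$$ (the value $+\infty$ is allowed). Eigenvalues are counted with multiplicity. *)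

theory Defs
  imports "HOL-Analysis.Analysis" "HOL-Computational_Algebra.Polynomial"
    "HOL-Library.Multiset" "HOL-Library.Extended_Real"
begin

text \<open>
  The vertex set is the finite type \<open>'v\<close>. An undirected graph is a symmetric irreflexive set of
  ordered pairs, so every edge occurs in both orientations. The values of \<open>\<sigma>\<close> and \<open>w\<close>
  outside \<open>E\<close> are irrelevant. Edges may have weight zero.
\<close>

locale signed_graph =
  fixes E :: "'v::finite rel"
    and \<sigma> :: "'v \<Rightarrow> 'v \<Rightarrow> int"
    and w :: "'v \<Rightarrow> 'v \<Rightarrow> real"
  assumes edges_sym: "sym E"
    and edges_irrefl: "irrefl E"
    and connected: "\<forall>u v. (u, v) \<in> E\<^sup>*"
    and sign_values: "(u, v) \<in> E \<Longrightarrow> \<sigma> u v = 1 \<or> \<sigma> u v = - 1"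
    and sign_sym: "(u, v) \<in> E \<Longrightarrow> \<sigma> u v = \<sigma> v u"
    and weight_nonneg: "(u, v) \<in> E \<Longrightarrow> 0 \<le> w u v"
    and weight_sym: "(u, v) \<in> E \<Longrightarrow> w u v = w v u"

definition pos_edges :: "'v rel \<Rightarrow> ('v \<Rightarrow> 'v \<Rightarrow> int) \<Rightarrow> 'v rel" where
  "pos_edges E \<sigma> = {(u, v) \<in> E. \<sigma> u v = 1}"

definition neg_edges :: "'v rel \<Rightarrow> ('v \<Rightarrow> 'v \<Rightarrow> int) \<Rightarrow> 'v rel" where
  "neg_edges E \<sigma> = {(u, v) \<in> E. \<sigma> u v = - 1}"

definition non_complete :: "'v rel \<Rightarrow> bool" where
  "non_complete E \<longleftrightarrow> (\<exists>u v. u \<noteq> v \<and> (u, v) \<notin> E)"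

definition positive_connected :: "'v rel \<Rightarrow> ('v \<Rightarrow> 'v \<Rightarrow> int) \<Rightarrow> bool" where
  "positive_connected E \<sigma> \<longleftrightarrow> (\<forall>u v. (u, v) \<in> (pos_edges E \<sigma>)\<^sup>*)"

definition weighted_degree :: "'v::finite rel \<Rightarrow> ('v \<Rightarrow> 'v \<Rightarrow> real) \<Rightarrow> 'v \<Rightarrow> real" where
  "weighted_degree F w i = (\<Sum>j | (i, j) \<in> F. w i j)"

definition laplacian :: "'v::finite rel \<Rightarrow> ('v \<Rightarrow> 'v \<Rightarrow> real) \<Rightarrow> real ^ 'v ^ 'v" where
  "laplacian F w = (\<chi> i j. if i = j then weighted_degree F w i
                          else if (i, j) \<in> F then - w i j else 0)"

definition signed_laplacian ::
  "'v::finite rel \<Rightarrow> ('v \<Rightarrow> 'v \<Rightarrow> int) \<Rightarrow> ('v \<Rightarrow> 'v \<Rightarrow> real) \<Rightarrow> real \<Rightarrow> real ^ 'v ^ 'v" where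
  "signed_laplacian E \<sigma> w \<epsilon> = laplacian (pos_edges E \<sigma>) w - \<epsilon> *\<^sub>R laplacian (neg_edges E \<sigma>) w"

definition positive_semidefinite :: "real ^ 'n ^ 'n \<Rightarrow> bool" where
  "positive_semidefinite A \<longleftrightarrow> transpose A = A \<and> (\<forall>x. 0 \<le> x \<bullet> (A *v x))"

text \<open>
  The supremum is taken in the extended reals. For a positive connected signed graph the set is empty
  only if the positive edges of nonzero weight do not connect the graph; the value is then \<open>- \<infinity>\<close>.
\<close>

definition consensus_index ::
  "'v::finite rel \<Rightarrow> ('v \<Rightarrow> 'v \<Rightarrow> int) \<Rightarrow> ('v \<Rightarrow> 'v \<Rightarrow> real) \<Rightarrow> ereal" where
  "consensus_index E \<sigma> w =
     Sup {ereal \<epsilon> | \<epsilon>. 0 < \<epsilon> \<and> positive_semidefinite (signed_laplacian E \<sigma> w \<epsilon>) \<and>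
                          rank (signed_laplacian E \<sigma> w \<epsilon>) = CARD('v) - 1}"

definition char_polynomial :: "real ^ 'n ^ 'n \<Rightarrow> real poly" where
  "char_polynomial A = det (mat [:0, 1:] - map_matrix (\<lambda>a. [:a:]) A)"

text \<open>
  The real eigenvalues in ascending order, each repeated according to its multiplicity as a root of
  the characteristic polynomial. For a symmetric matrix of size \<open>n\<close> the list has length \<open>n\<close>.
\<close>

definition eigenvalues_ascending :: "real ^ 'n ^ 'n \<Rightarrow> real list" where
  "eigenvalues_ascending A = sorted_list_of_multiset (proots (char_polynomial A))"

definition second_smallest_eigenvalue :: "real ^ 'n ^ 'n \<Rightarrow> real" where
  "second_smallest_eigenvalue A = eigenvalues_ascending A ! 1"

end

theory Submission
  imports Defs
begin

text \<open>
  Let \<open>A = L\<^sub>+ - \<epsilon> L\<^sub>-\<close>. Its diagonal entries are the numbers \<open>d\<^sub>x\<^sup>+ - \<epsilon> d\<^sub>x\<^sup>-\<close>. If \<open>u \<noteq> v\<close> are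
  not adjacent, then \<open>A u v = 0\<close>, so on the plane spanned by the coordinate vectors of \<open>u\<close> and \<open>v\<close>
  the quadratic form of \<open>A\<close> is diagonal and at most \<open>M\<^sub>\<epsilon>\<close> times the squared norm. By the
  Courant-Fischer principle a symmetric matrix whose Rayleigh quotient is at most \<open>m\<close> on a plane has
  second smallest eigenvalue at most \<open>m\<close>, which is the claim.

  The Courant-Fischer bound (\<open>second_smallest_eigenvalue_le_if_form_le\<close>) rests on the orthogonal
  diagonalization of real symmetric matrices (\<open>symmetric_matrix_orthogonally_diagonalizable\<close>),
  which also shows that the roots of the characteristic polynomial, with multiplicity, are exactly
  the diagonal entries (\<open>proots_char_polynomial_diagonalized\<close>).
\<close>

section \<open>Orthogonal diagonalization of real symmetric matrices\<close>

lemma inner_transpose_matrix_vector: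
  fixes P :: "real ^ 'n ^ 'm"
  shows "x \<bullet> (transpose P *v y) = (P *v x) \<bullet> y"
  using dot_lmul_matrix[of x "transpose P" y] by simp

lemma symmetric_matrix_inner:
  fixes A :: "real ^ 'n ^ 'n"
  assumes "transpose A = A"
  shows "(A *v x) \<bullet> y = x \<bullet> (A *v y)"
  using inner_transpose_matrix_vector[of x A y] assms by simp

text \<open>
  A minimizer \<open>p\<close> of the quadratic form on the unit sphere of \<open>S\<close> is an eigenvector: if \<open>l\<close> is the
  minimum, then \<open>t \<mapsto> (p + t y) \<bullet> (A - l) (p + t y)\<close> is nonnegative and vanishes at \<open>t = 0\<close>, so
  its linear coefficient \<open>2 y \<bullet> (A - l) p\<close> vanishes; take \<open>y = (A - l) p\<close>.
\<close>

lemma symmetric_matrix_eigenvector_in_invariant_subspace: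
  fixes A :: "real ^ 'n ^ 'n"
  assumes sym: "transpose A = A" and S: "subspace S"
    and inv: "\<And>x. x \<in> S \<Longrightarrow> A *v x \<in> S" and nz: "S \<noteq> {0}"
  obtains p l where "p \<in> S" "norm p = 1" "A *v p = l *\<^sub>R p"
proof -
  let ?K = "S \<inter> sphere 0 1"
  have "compact ?K"
    by (simp add: S closed_subspace closed_Int_compact)
  moreover have "?K \<noteq> {}"
  proof -
    obtain y where y: "y \<in> S" "y \<noteq> 0" using nz S subspace_0 by fastforce
    have "(1 / norm y) *\<^sub>R y \<in> ?K" using y S by (simp add: subspace_scale)
    then show ?thesis by blast
  qed
  moreover have "continuous_on ?K (\<lambda>x. x \<bullet> (A *v x))"
    by (intro continuous_intros matrix_vector_mult_linear_continuous_on)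
  ultimately obtain p where p: "p \<in> ?K"
      and min: "\<And>x. x \<in> ?K \<Longrightarrow> p \<bullet> (A *v p) \<le> x \<bullet> (A *v x)"
    using continuous_attains_inf[of ?K "\<lambda>x. x \<bullet> (A *v x)"] by blast
  have p1: "p \<in> S" "norm p = 1" using p by auto
  define l where "l = p \<bullet> (A *v p)"
  have form: "l * (x \<bullet> x) \<le> x \<bullet> (A *v x)" if "x \<in> S" for x
  proof (cases "x = 0")
    case False
    have "(1 / norm x) *\<^sub>R x \<in> ?K" using that False S by (simp add: subspace_scale)
    from min[OF this] have "l \<le> (x \<bullet> (A *v x)) / (norm x)\<^sup>2"
      by (simp add: l_def matrix_vector_mult_scaleR power2_eq_square)
    then show ?thesis using False by (simp add: field_simps power2_norm_eq_inner)
  qed simp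
  define r where "r = A *v p - l *\<^sub>R p"
  have rS: "r \<in> S" unfolding r_def using S inv p1 by (simp add: subspace_diff subspace_scale)
  define c where "c = r \<bullet> (A *v r) - l * (r \<bullet> r)"
  have quad: "0 \<le> 2 * t * (r \<bullet> r) + t\<^sup>2 * c" for t
  proof -
    have "p + t *\<^sub>R r \<in> S" using S rS p1 by (simp add: subspace_add subspace_scale)
    from form[OF this]
    have "0 \<le> (p + t *\<^sub>R r) \<bullet> (A *v (p + t *\<^sub>R r)) - l * ((p + t *\<^sub>R r) \<bullet> (p + t *\<^sub>R r))"
      by simp
    also have "\<dots> = (l - l * (p \<bullet> p)) + 2 * t * (r \<bullet> (A *v p) - l * (r \<bullet> p)) + t\<^sup>2 * c"
      using symmetric_matrix_inner[OF sym, of p r]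
      by (simp add: c_def l_def matrix_vector_right_distrib matrix_vector_mult_scaleR
          inner_add_left inner_add_right algebra_simps inner_commute power2_eq_square)
    also have "p \<bullet> p = 1" using p1 by (simp add: norm_eq_1)
    also have "r \<bullet> (A *v p) - l * (r \<bullet> p) = r \<bullet> r"
      by (subst (3) r_def) (simp add: inner_diff_right)
    finally show ?thesis by simp
  qed
  have "r \<bullet> r = 0"
  proof (rule ccontr)
    assume "r \<bullet> r \<noteq> 0"
    then have pos: "0 < r \<bullet> r" by simp
    \<comment> \<open>For this small negative \<open>t\<close> the linear term dominates the quadratic one.\<close>
    define t where "t = - (r \<bullet> r) / (1 + \<bar>c\<bar>)"
    have "t < 0" using pos by (simp add: t_def divide_neg_pos)
    have "2 * t * (r \<bullet> r) + t\<^sup>2 * c = t * (2 * (r \<bullet> r) + t * c)"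
      by (simp add: algebra_simps power2_eq_square)
    moreover have "\<bar>t * c\<bar> \<le> r \<bullet> r"
    proof -
      have "\<bar>t * c\<bar> = (r \<bullet> r) * (\<bar>c\<bar> / (1 + \<bar>c\<bar>))" by (simp add: t_def abs_mult)
      also have "\<dots> \<le> (r \<bullet> r) * 1" by (rule mult_left_mono) auto
      finally show ?thesis by simp
    qed
    then have "t * (2 * (r \<bullet> r) + t * c) < 0"
      using \<open>t < 0\<close> pos by (intro mult_neg_pos) linarith+
    ultimately show False using quad[of t] by simp
  qed
  then have "A *v p = l *\<^sub>R p" by (simp add: r_def)
  with p1 that show ?thesis by blast
qed

text \<open>
  The orthogonal complement of an eigenvector inside an invariant subspace is again invariant, and
  it has smaller dimension.
\<close>

lemma symmetric_matrix_eigenbasis_of_invariant_subspace: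
  fixes A :: "real ^ 'n ^ 'n"
  assumes sym: "transpose A = A" and "subspace S" and "\<And>x. x \<in> S \<Longrightarrow> A *v x \<in> S"
  shows "\<exists>B\<subseteq>S. pairwise orthogonal B \<and> (\<forall>b\<in>B. norm b = 1 \<and> (\<exists>l. A *v b = l *\<^sub>R b)) \<and> S \<subseteq> span B"
  using assms(2,3)
proof (induction "dim S" arbitrary: S rule: less_induct)
  case less
  show ?case
  proof (cases "S = {0}")
    case True
    then show ?thesis by (intro exI[of _ "{}"]) simp
  next
    case False
    obtain p l where p: "p \<in> S" "norm p = 1" and eig: "A *v p = l *\<^sub>R p"
      using symmetric_matrix_eigenvector_in_invariant_subspace[OF sym less.prems False] .
    define T where "T = {x \<in> S. p \<bullet> x = 0}"
    have T: "subspace T"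
      using less.prems(1) by (auto simp: T_def subspace_def inner_add_right)
    have pp: "p \<bullet> p = 1" using p by (simp add: norm_eq_1)
    have "p \<notin> T" using pp by (simp add: T_def)
    moreover have "T \<subseteq> S" by (auto simp: T_def)
    ultimately have "T \<subset> S" using p by blast
    then have "dim T < dim S"
      using T less.prems(1) by (metis dim_psubset span_eq_iff)
    moreover have "A *v x \<in> T" if "x \<in> T" for x
      using that less.prems(2) symmetric_matrix_inner[OF sym, of p x] by (simp add: T_def eig)
    ultimately obtain B where B: "B \<subseteq> T" "pairwise orthogonal B"
        "\<forall>b\<in>B. norm b = 1 \<and> (\<exists>l. A *v b = l *\<^sub>R b)" "T \<subseteq> span B"
      using less.hyps[OF _ T] by blast
    have "S \<subseteq> span (insert p B)"
    proof
      fix x assume "x \<in> S"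
      then have "x - (p \<bullet> x) *\<^sub>R p \<in> T"
        using less.prems(1) p pp by (simp add: T_def subspace_diff subspace_scale inner_diff_right)
      then show "x \<in> span (insert p B)"
        using B(4) span_breakdown_eq by blast
    qed
    moreover have "pairwise orthogonal (insert p B)"
      using B(1,2) by (auto simp: pairwise_insert T_def orthogonal_def inner_commute)
    moreover have "insert p B \<subseteq> S" using p B(1) by (auto simp: T_def)
    ultimately show ?thesis using B(3) p eig by (intro exI[of _ "insert p B"]) auto
  qed
qed

theorem symmetric_matrix_orthogonally_diagonalizable:
  fixes A :: "real ^ 'n ^ 'n"
  assumes sym: "transpose A = A"
  obtains P :: "real ^ 'n ^ 'n" and d where "orthogonal_matrix P"
    and "A = transpose P ** (\<chi> i j. if i = j then d i else 0) ** P"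
proof -
  obtain B where B: "pairwise orthogonal B" "\<forall>b\<in>B. norm b = 1 \<and> (\<exists>l. A *v b = l *\<^sub>R b)"
      and span: "UNIV \<subseteq> span B"
    using symmetric_matrix_eigenbasis_of_invariant_subspace[OF sym, of UNIV] by auto
  have "0 \<notin> B" using B(2) by force
  then have ind: "independent B" using B(1) by (rule pairwise_orthogonal_independent[rotated])
  have "card B = CARD('n)"
    using basis_card_eq_dim[of B UNIV] ind span by simp
  then obtain f :: "'n \<Rightarrow> real ^ 'n" where f: "bij_betw f UNIV B"
    using finite_same_card_bij[of "UNIV :: 'n set" B] ind independent_imp_finite by auto
  have fB: "f i \<in> B" for i using f by (auto simp: bij_betw_def)
  have "\<forall>i. \<exists>l. A *v f i = l *\<^sub>R f i" using B(2) fB by blast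
  then obtain d where d: "\<And>i. A *v f i = d i *\<^sub>R f i" by metis
  define P :: "real ^ 'n ^ 'n" where "P = (\<chi> i. f i)"
  define D :: "real ^ 'n ^ 'n" where "D = (\<chi> i j. if i = j then d i else 0)"
  have ortho: "f i \<bullet> f j = (if i = j then 1 else 0)" for i j
  proof (cases "i = j")
    case True
    then show ?thesis using B(2) fB by (simp add: norm_eq_1)
  next
    case False
    then have "f i \<noteq> f j" using f by (auto simp: bij_betw_def inj_on_def)
    then show ?thesis using B(1) fB False by (simp add: pairwise_def orthogonal_def)
  qed
  have "P ** transpose P = mat 1"
    using ortho by (simp add: vec_eq_iff matrix_matrix_mult_def transpose_def mat_def P_def inner_vec_def)
  then have P: "orthogonal_matrix P"
    using matrix_left_right_inverse orthogonal_matrix_def by blast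
  have "A ** transpose P = transpose P ** D"
  proof -
    have "(A ** transpose P) $ i $ j = (transpose P ** D) $ i $ j" for i j
    proof -
      have "(A ** transpose P) $ i $ j = (A *v f j) $ i"
        by (simp add: matrix_matrix_mult_def matrix_vector_mult_def transpose_def P_def)
      also have "\<dots> = (transpose P ** D) $ i $ j"
        by (simp add: d matrix_matrix_mult_def transpose_def P_def D_def if_distrib cong: if_cong)
      finally show ?thesis .
    qed
    then show ?thesis by (simp add: vec_eq_iff)
  qed
  then have "A ** (transpose P ** P) = transpose P ** D ** P"
    by (simp add: matrix_mul_assoc)
  then have "A = transpose P ** D ** P"
    using P by (simp add: orthogonal_matrix)
  with P that show ?thesis unfolding D_def by blast
qed

section \<open>The second smallest eigenvalue\<close>

text \<open>
  Over an infinite field the characteristic polynomial is determined by its values, which are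
  determinants of real matrices.
\<close>

lemma poly_char_polynomial: "poly (char_polynomial A) x = det (mat x - A)"
  by (simp add: char_polynomial_def det_def poly_sum poly_prod mat_def map_matrix_def
      if_distrib[of "\<lambda>p. poly p x"] cong: if_cong)

lemma matrix_mult_diff_distrib:
  fixes A :: "'a::ring_1 ^ 'n ^ 'm"
  shows "A ** (B - C) = A ** B - A ** C"
  by (simp add: vec_eq_iff matrix_matrix_mult_def right_diff_distrib sum_subtractf)

lemma matrix_mult_diff_rdistrib:
  fixes A :: "'a::ring_1 ^ 'n ^ 'm"
  shows "(A - B) ** C = A ** C - B ** C"
  by (simp add: vec_eq_iff matrix_matrix_mult_def left_diff_distrib sum_subtractf)

lemma proots_char_polynomial_diagonalized:
  fixes P :: "real ^ 'n ^ 'n"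
  assumes P: "orthogonal_matrix P"
  shows "proots (char_polynomial (transpose P ** (\<chi> i j. if i = j then d i else 0) ** P))
    = image_mset d (mset_set UNIV)"
proof -
  let ?D = "(\<chi> i j. if i = j then d i else 0) :: real ^ 'n ^ 'n"
  let ?A = "transpose P ** ?D ** P"
  have "poly (char_polynomial ?A) x = (\<Prod>i\<in>UNIV. x - d i)" for x
  proof -
    have "transpose P ** mat x ** P = x *\<^sub>R (transpose P ** P)"
      by (simp add: vec_eq_iff matrix_matrix_mult_def mat_def sum_distrib_left mult_ac
          if_distrib[of "\<lambda>z. _ * z"] cong: if_cong)
    also have "\<dots> = mat x" using P by (simp add: orthogonal_matrix vec_eq_iff mat_def)
    finally have "mat x = transpose P ** mat x ** P" ..
    then have "mat x - ?A = transpose P ** (mat x - ?D) ** P"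
      by (simp add: matrix_mult_diff_distrib matrix_mult_diff_rdistrib)
    then have "det (mat x - ?A) = det (transpose P ** P) * det (mat x - ?D)"
      by (simp add: det_mul)
    also have "\<dots> = det (mat x - ?D)" using P by (simp add: orthogonal_matrix)
    also have "\<dots> = (\<Prod>i\<in>UNIV. x - d i)"
      by (subst det_diagonal) (auto simp: mat_def)
    finally show ?thesis by (simp add: poly_char_polynomial)
  qed
  then have "char_polynomial ?A = (\<Prod>i\<in>UNIV. [:- d i, 1:])"
    by (simp add: poly_prod fun_eq_iff flip: poly_eq_poly_eq_iff)
  then show ?thesis
    by (simp add: proots_prod sum_unfold_sum_mset flip: image_mset.compositionality)
qed

lemma sorted_list_of_multiset_nth_1_le:
  fixes m :: "'a::linorder"
  assumes "2 \<le> size (filter_mset (\<lambda>x. x \<le> m) M)"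
  shows "sorted_list_of_multiset M ! 1 \<le> m"
proof -
  define xs where "xs = sorted_list_of_multiset M"
  have M: "M = mset xs" by (simp add: xs_def)
  have sorted: "sorted xs" by (simp add: xs_def)
  have len: "2 \<le> length (filter (\<lambda>x. x \<le> m) xs)"
    using assms by (simp add: M flip: mset_filter)
  then have "2 \<le> length xs" using length_filter_le le_trans by blast
  then obtain a b ys where xs: "xs = a # b # ys"
    by (auto simp: numeral_2_eq_2 Suc_le_length_iff)
  have "b \<le> m"
  proof (rule ccontr)
    assume "\<not> b \<le> m"
    then have "filter (\<lambda>x. x \<le> m) (b # ys) = []"
      using sorted xs by (auto simp: filter_empty_conv)
    then have "length (filter (\<lambda>x. x \<le> m) xs) \<le> 1" by (simp add: xs)
    with len show False by simp
  qed
  then show ?thesis unfolding xs_def[symmetric] by (simp add: xs)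
qed

lemma subspace_dim_ge_2_obtains_orthogonal:
  fixes p :: "'a::euclidean_space"
  assumes W: "subspace W" and dim: "2 \<le> dim W"
  obtains x where "x \<in> W" "x \<noteq> 0" "p \<bullet> x = 0"
proof -
  have "\<exists>x\<in>W. x \<noteq> 0 \<and> p \<bullet> x = 0"
  proof (rule ccontr)
    assume *: "\<not> (\<exists>x\<in>W. x \<noteq> 0 \<and> p \<bullet> x = 0)"
    have "W \<noteq> {0}" using dim by auto
    then obtain y where y: "y \<in> W" "y \<noteq> 0" using W subspace_0 by fastforce
    then have py: "p \<bullet> y \<noteq> 0" using * by blast
    have "W \<subseteq> span {y}"
    proof
      fix x assume x: "x \<in> W"
      have "x - ((p \<bullet> x) / (p \<bullet> y)) *\<^sub>R y \<in> W" using W x y by (simp add: subspace_diff subspace_scale)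
      moreover have "p \<bullet> (x - ((p \<bullet> x) / (p \<bullet> y)) *\<^sub>R y) = 0" using py by (simp add: inner_diff_right)
      ultimately have "x - ((p \<bullet> x) / (p \<bullet> y)) *\<^sub>R y = 0" using * by blast
      then show "x \<in> span {y}" by (auto simp: span_singleton)
    qed
    then have "dim W \<le> card {y}" by (intro dim_le_card) auto
    with dim show False by simp
  qed
  then show ?thesis using that by blast
qed

text \<open>
  The easy half of the Courant-Fischer principle. If at most one eigenvalue, with eigenvector \<open>p\<close>,
  were at most \<open>m\<close>, then the form would exceed \<open>m\<close> times the squared norm at every nonzero vector
  orthogonal to \<open>p\<close>, and a subspace of dimension two contains such a vector.
\<close>

theorem second_smallest_eigenvalue_le_if_form_le:
  fixes A :: "real ^ 'n ^ 'n"
  assumes sym: "transpose A = A" and W: "subspace W" "2 \<le> dim W"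
    and le: "\<And>x. x \<in> W \<Longrightarrow> x \<bullet> (A *v x) \<le> m * (x \<bullet> x)"
  shows "second_smallest_eigenvalue A \<le> m"
proof -
  obtain P :: "real ^ 'n ^ 'n" and d where P: "orthogonal_matrix P"
    and A: "A = transpose P ** (\<chi> i j. if i = j then d i else 0) ** P" (is "A = _ ** ?D ** _")
    using symmetric_matrix_orthogonally_diagonalizable[OF sym] .
  have norm: "x \<bullet> x = (\<Sum>i\<in>UNIV. ((P *v x) $ i)\<^sup>2)" for x
  proof -
    have "x \<bullet> x = x \<bullet> ((transpose P ** P) *v x)" using P by (simp add: orthogonal_matrix)
    also have "\<dots> = (P *v x) \<bullet> (P *v x)"
      by (simp only: inner_transpose_matrix_vector flip: matrix_vector_mul_assoc)
    finally show ?thesis by (simp add: inner_vec_def power2_eq_square)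
  qed
  have form: "x \<bullet> (A *v x) = (\<Sum>i\<in>UNIV. d i * ((P *v x) $ i)\<^sup>2)" for x
  proof -
    have "x \<bullet> (A *v x) = (P *v x) \<bullet> (?D *v (P *v x))"
      unfolding A by (simp only: inner_transpose_matrix_vector flip: matrix_vector_mul_assoc)
    also have "?D *v (P *v x) = (\<chi> i. d i * (P *v x) $ i)"
      by (subst matrix_vector_mult_def) (simp add: vec_eq_iff if_distrib[of "\<lambda>z. z * _"] cong: if_cong)
    finally show ?thesis by (simp add: inner_vec_def power2_eq_square algebra_simps)
  qed
  have "2 \<le> card {i. d i \<le> m}"
  proof (rule ccontr)
    assume "\<not> 2 \<le> card {i. d i \<le> m}"
    then have "card {i. d i \<le> m} \<le> Suc 0" by simp
    then have unique: "i = j" if "d i \<le> m" "d j \<le> m" for i j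
      using that by (simp add: card_le_Suc0_iff_eq)
    \<comment> \<open>If no \<open>d i\<close> is at most \<open>m\<close>, the index \<open>k\<close> is arbitrary.\<close>
    define k where "k = (SOME i. d i \<le> m)"
    have k: "m < d i" if "i \<noteq> k" for i
      using that unique[of i k] someI[of "\<lambda>i. d i \<le> m" i] unfolding k_def by linarith
    obtain x where x: "x \<in> W" "x \<noteq> 0" "P $ k \<bullet> x = 0"
      using subspace_dim_ge_2_obtains_orthogonal[OF W] .
    have k0: "(P *v x) $ k = 0" using x(3) by (simp add: matrix_vector_mul_component)
    have "(\<Sum>i\<in>UNIV. (d i - m) * ((P *v x) $ i)\<^sup>2) \<le> 0"
      using le[OF x(1)] by (simp add: norm form sum_distrib_left algebra_simps sum_subtractf)
    moreover have nonneg: "0 \<le> (d i - m) * ((P *v x) $ i)\<^sup>2" for i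
      using k[of i] k0 by (cases "i = k") auto
    ultimately have "(\<Sum>i\<in>UNIV. (d i - m) * ((P *v x) $ i)\<^sup>2) = 0"
      by (intro order_antisym sum_nonneg) auto
    then have zero: "(d i - m) * ((P *v x) $ i)\<^sup>2 = 0" for i
      using nonneg by (subst (asm) sum_nonneg_eq_0_iff) auto
    have "(P *v x) $ i = 0" for i
    proof (cases "i = k")
      case False
      then show ?thesis using zero[of i] k[of i] by simp
    qed (simp add: k0)
    then have "x \<bullet> x = 0" by (simp add: norm)
    with x(2) show False by simp
  qed
  also have "card {i. d i \<le> m} = size (filter_mset (\<lambda>x. x \<le> m) (image_mset d (mset_set UNIV)))"
    by (simp add: filter_mset_image_mset)
  finally show ?thesis
    unfolding second_smallest_eigenvalue_def eigenvalues_ascending_def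
    by (subst A) (simp only: proots_char_polynomial_diagonalized[OF P] sorted_list_of_multiset_nth_1_le)
qed

text \<open>
  A vanishing entry \<open>A u v\<close> removes the cross term of the quadratic form on the plane of the two
  coordinate vectors.
\<close>

lemma second_smallest_eigenvalue_le_if_zero_entry:
  fixes A :: "real ^ 'n ^ 'n"
  assumes sym: "transpose A = A" and uv: "u \<noteq> v" "A $ u $ v = 0"
    and le: "A $ u $ u \<le> m" "A $ v $ v \<le> m"
  shows "second_smallest_eigenvalue A \<le> m"
proof (rule second_smallest_eigenvalue_le_if_form_le[OF sym])
  let ?W = "span {axis u 1, axis v 1 :: real ^ 'n}"
  show "subspace ?W" by simp
  have "independent {axis u 1, axis v 1 :: real ^ 'n}"
    using uv(1) by (intro pairwise_orthogonal_independent)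
      (auto simp: pairwise_insert orthogonal_def inner_axis_axis axis_eq_0_iff)
  then show "2 \<le> dim ?W"
    using uv(1) by (simp add: dim_eq_card_independent axis_eq_axis)
  fix x assume "x \<in> ?W"
  then obtain a b where x: "x = a *\<^sub>R axis u 1 + b *\<^sub>R axis v 1"
    by (auto simp: span_insert span_singleton algebra_simps)
  have vu: "A $ v $ u = 0" using sym uv(2) by (metis transpose_def vec_lambda_beta)
  have entry: "axis i 1 \<bullet> (A *v axis j 1) = A $ i $ j" for i j
    by (simp add: inner_axis' matrix_vector_mult_basis column_def)
  have "x \<bullet> (A *v x) = a\<^sup>2 * A $ u $ u + b\<^sup>2 * A $ v $ v"
    by (simp add: x matrix_vector_right_distrib matrix_vector_mult_scaleR inner_add_left
        inner_add_right entry uv vu power2_eq_square)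
  also have "\<dots> \<le> a\<^sup>2 * m + b\<^sup>2 * m" using le by (intro add_mono mult_left_mono) auto
  also have "\<dots> = m * (x \<bullet> x)"
    using uv(1) by (simp add: x inner_add_left inner_add_right inner_axis_axis power2_eq_square
        algebra_simps)
  finally show "x \<bullet> (A *v x) \<le> m * (x \<bullet> x)" .
qed

section \<open>Signed Laplacians\<close>

lemma (in signed_graph) transpose_signed_laplacian:
  "transpose (signed_laplacian E \<sigma> w \<epsilon>) = signed_laplacian E \<sigma> w \<epsilon>"
proof -
  have "(i, j) \<in> E \<longleftrightarrow> (j, i) \<in> E" for i j using edges_sym by (auto dest: symD)
  then show ?thesis
    using sign_sym weight_sym
    by (auto simp: vec_eq_iff transpose_def signed_laplacian_def laplacian_def pos_edges_def
        neg_edges_def)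
qed

theorem theorem1p1:
  fixes E :: "'v::finite rel"
    and \<sigma> :: "'v \<Rightarrow> 'v \<Rightarrow> int"
    and w :: "'v \<Rightarrow> 'v \<Rightarrow> real"
    and \<epsilon> :: real
  assumes "signed_graph E \<sigma> w"
    and "non_complete E"
    and "positive_connected E \<sigma>"
    and "ereal \<epsilon> < consensus_index E \<sigma> w"
  shows "second_smallest_eigenvalue (signed_laplacian E \<sigma> w \<epsilon>)
       \<le> Max (range (\<lambda>x. weighted_degree (pos_edges E \<sigma>) w x
                          - \<epsilon> * weighted_degree (neg_edges E \<sigma>) w x))"
    (is "_ \<le> Max (range ?d)")
proof -
  let ?A = "signed_laplacian E \<sigma> w \<epsilon>"
  obtain u v where uv: "u \<noteq> v" "(u, v) \<notin> E" using assms(2) by (auto simp: non_complete_def)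
  have "?A $ x $ x = ?d x" for x by (simp add: signed_laplacian_def laplacian_def)
  then have diag: "?A $ x $ x \<le> Max (range ?d)" for x by simp
  have "?A $ u $ v = 0"
    using uv by (simp add: signed_laplacian_def laplacian_def pos_edges_def neg_edges_def)
  with diag uv(1) show ?thesis
    using signed_graph.transpose_signed_laplacian[OF assms(1)]
    by (intro second_smallest_eigenvalue_le_if_zero_entry) auto
qed

end
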